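(* Let $G$ be a (finite or infinite) group and let $A\subseteq G$. (1) $C$ is a component of the Cayley graph $\mathrm{Cay}(G,A)$ if and only if there is a unique left coset $X$ of $\langle A\rangle$ in $G$ such that $C=\mathrm{Cay}(G,A)[X]$. (2) $C$ is a component of the Cayley digraph $\overrightarrow{\mathrm{Cay}}(G,A)$ if and only if there is a unique left coset $X$ of $\langle A\rangle$ in $G$ such that $C=\overrightarrow{\mathrm{Cay}}(G,A)[X]$.
   Context: $\langle A\rangle$ denotes the subgroup of $G$ generated by $A$, and $e$ is the identity of $G$. The Cayley digraph $\overrightarrow{\mathrm{Cay}}(G,A)$ is the directed graph with vertex set $G$ and arc set $\{(g,ga): g\in G,\ a\in A,\ a\neq e\}$. The (undirected) Cayley graph $\mathrm{Cay}(G,A)$ is its underlying graph: vertex set $G$, with $\{u,v\}$ an edge if and only if $u=va$ or $v=ua$ for some $a\in A\setminus\{e\}$. For a (di)graph $\Gamma$ and a set $X$ of vertices, $\Gamma[X]$ is the sub(di)graph induced by $X$. For a graph with vertex set $V$, the equivalence relation $\mathfrak{p}$ on $V$ is: $u\,\mathfrak{p}\,v$ if and only if $u=v$ or there is a path from $u$ to $v$. A component of a graph is the subgraph induced by an equivalence class of $\mathfrak{p}$. A component of a digraph means a weakly connected component, i.e. the subdigraph induced by an equivalence class of the relation $\mathfrak{p}$ of its underlying undirected graph. *)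

theory Defs
  imports
    "HOL-Algebra.Generated_Groups"
    "HOL-Algebra.Left_Coset"
    "Graph_Theory.Digraph_Component"
begin

text \<open>
  Digraphs are those of \<^theory>\<open>Graph_Theory.Digraph\<close>. That entry encodes graphs as
  symmetric digraphs; here an undirected graph has unordered pairs as edges. A singleton
  edge would be a loop.
\<close>

record 'a ugraph =
  uverts :: "'a set"
  uedges :: "'a set set"

definition ugraph_path :: "'a ugraph \<Rightarrow> 'a \<Rightarrow> 'a list \<Rightarrow> 'a \<Rightarrow> bool" where
  "ugraph_path \<Gamma> u p v \<longleftrightarrow>
     p \<noteq> [] \<and> hd p = u \<and> last p = v \<and> distinct p \<and> set p \<subseteq> uverts \<Gamma> \<and>
     successively (\<lambda>x y. {x, y} \<in> uedges \<Gamma>) p"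

definition path_rel :: "'a ugraph \<Rightarrow> ('a \<times> 'a) set" where
  "path_rel \<Gamma> =
     {(u, v). u \<in> uverts \<Gamma> \<and> v \<in> uverts \<Gamma> \<and> (u = v \<or> (\<exists>p. ugraph_path \<Gamma> u p v))}"

definition induce_ugraph :: "'a ugraph \<Rightarrow> 'a set \<Rightarrow> 'a ugraph" where
  "induce_ugraph \<Gamma> X = \<lparr>uverts = X, uedges = {e \<in> uedges \<Gamma>. e \<subseteq> X}\<rparr>"

definition ugraph_component :: "'a ugraph \<Rightarrow> 'a ugraph \<Rightarrow> bool" where
  "ugraph_component \<Gamma> C \<longleftrightarrow> (\<exists>X \<in> uverts \<Gamma> // path_rel \<Gamma>. C = induce_ugraph \<Gamma> X)"

definition underlying_ugraph :: "('a, 'b) pre_digraph \<Rightarrow> 'a ugraph" where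
  "underlying_ugraph D =
     \<lparr>uverts = verts D, uedges = (\<lambda>a. {tail D a, head D a}) ` arcs D\<rparr>"

definition weak_component :: "('a, 'b) pre_digraph \<Rightarrow> ('a, 'b) pre_digraph \<Rightarrow> bool" where
  "weak_component D C \<longleftrightarrow>
     (\<exists>X \<in> verts D // path_rel (underlying_ugraph D). C = induce_subgraph D X)"

definition cayley_digraph :: "('a, 'm) monoid_scheme \<Rightarrow> 'a set \<Rightarrow> ('a, 'a \<times> 'a) pre_digraph" where
  "cayley_digraph G A =
     \<lparr>verts = carrier G,
      arcs = {(g, g \<otimes>\<^bsub>G\<^esub> a) | g a. g \<in> carrier G \<and> a \<in> A \<and> a \<noteq> \<one>\<^bsub>G\<^esub>},
      tail = fst, head = snd\<rparr>"

definition cayley_graph :: "('a, 'm) monoid_scheme \<Rightarrow> 'a set \<Rightarrow> 'a ugraph" where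
  "cayley_graph G A =
     \<lparr>uverts = carrier G,
      uedges = {{u, v} | u v. u \<in> carrier G \<and> v \<in> carrier G \<and>
                  (\<exists>a \<in> A - {\<one>\<^bsub>G\<^esub>}. u = v \<otimes>\<^bsub>G\<^esub> a \<or> v = u \<otimes>\<^bsub>G\<^esub> a)}\<rparr>"

lemma underlying_cayley_digraph:
  assumes "group G" and "A \<subseteq> carrier G"
  shows "underlying_ugraph (cayley_digraph G A) = cayley_graph G A"
proof -
  interpret group G by fact
  have "(\<lambda>p. {fst p, snd p}) ` {(g, g \<otimes>\<^bsub>G\<^esub> a) | g a. g \<in> carrier G \<and> a \<in> A \<and> a \<noteq> \<one>\<^bsub>G\<^esub>}
      = {{u, v} | u v. u \<in> carrier G \<and> v \<in> carrier G \<and>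
                  (\<exists>a \<in> A - {\<one>\<^bsub>G\<^esub>}. u = v \<otimes>\<^bsub>G\<^esub> a \<or> v = u \<otimes>\<^bsub>G\<^esub> a)}" (is "?L = ?R")
  proof (intro equalityI subsetI)
    fix e assume "e \<in> ?L"
    then obtain g a where "g \<in> carrier G" "a \<in> A" "a \<noteq> \<one>\<^bsub>G\<^esub>" "e = {g, g \<otimes>\<^bsub>G\<^esub> a}"
      by auto
    moreover from this have "g \<otimes>\<^bsub>G\<^esub> a \<in> carrier G" using assms(2) by auto
    ultimately show "e \<in> ?R" by blast
  next
    fix e assume "e \<in> ?R"
    then obtain g a where "g \<in> carrier G" "a \<in> A" "a \<noteq> \<one>\<^bsub>G\<^esub>" "e = {g, g \<otimes>\<^bsub>G\<^esub> a}"
      by (auto simp: insert_commute)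
    then show "e \<in> ?L" by (auto simp: image_iff)
  qed
  then show ?thesis
    by (simp add: underlying_ugraph_def cayley_digraph_def cayley_graph_def)
qed

end

theory Submission
  imports Defs
begin

text \<open>
  Walking along an edge of the Cayley graph multiplies on the right by some \<open>a\<close> or its inverse,
  with \<open>a \<in> A\<close>; hence the vertices that can be reached from \<open>u\<close> are the products of \<open>u\<close> with words
  in \<open>A\<close> and the inverses of its elements, that is, the left coset of \<open>\<langle>A\<rangle>\<close> through \<open>u\<close>.
  Uniqueness of the coset is immediate, as an induced subgraph determines its vertex set.
\<close>

text \<open>Turns reachability into a reflexive transitive closure, which allows induction along
  walks. Membership in \<open>uverts\<close> is demanded because the record type does not force
  edges to join vertices.\<close>

definition adj_rel :: "'a ugraph \<Rightarrow> ('a \<times> 'a) set" where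
  "adj_rel \<Gamma> = {(x, y). x \<in> uverts \<Gamma> \<and> y \<in> uverts \<Gamma> \<and> {x, y} \<in> uedges \<Gamma>}"

text \<open>A path must stay \<open>distinct\<close>: if \<open>w\<close> is new it is appended, and
  if the path already visits \<open>w\<close> it is cut off there.\<close>

lemma ugraph_path_snoc:
  assumes "ugraph_path \<Gamma> u p v" "(v, w) \<in> adj_rel \<Gamma>"
  shows "\<exists>q. ugraph_path \<Gamma> u q w"
proof (cases "w \<in> set p")
  case True
  then obtain xs ys where "p = xs @ w # ys" by (meson split_list)
  then have p: "p = (xs @ [w]) @ ys" by simp
  have "ugraph_path \<Gamma> u (xs @ [w]) w"
    using assms(1) unfolding ugraph_path_def p successively_append_iff[of _ "xs @ [w]" ys]
    \<comment> \<open>The split on \<open>xs\<close> settles the start vertex: for empty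
      \<open>xs\<close> it is \<open>w\<close> itself.\<close>
    by (cases xs) auto
  then show ?thesis by blast
next
  case False
  then have "ugraph_path \<Gamma> u (p @ [w]) w"
    using assms unfolding ugraph_path_def adj_rel_def
    by (auto simp: successively_append_iff)
  then show ?thesis by blast
qed

lemma rtrancl_imp_ugraph_path:
  assumes "(u, v) \<in> (adj_rel \<Gamma>)\<^sup>*" "u \<in> uverts \<Gamma>"
  shows "\<exists>p. ugraph_path \<Gamma> u p v"
  using assms(1)
proof induction
  case base
  have "ugraph_path \<Gamma> u [u] u" using assms(2) by (simp add: ugraph_path_def)
  then show ?case by blast
next
  case (step v w)
  then show ?case using ugraph_path_snoc by metis
qed

lemma successively_imp_rtrancl:
  assumes "p \<noteq> []" "set p \<subseteq> uverts \<Gamma>" "successively (\<lambda>x y. {x, y} \<in> uedges \<Gamma>) p"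
  shows "(hd p, last p) \<in> (adj_rel \<Gamma>)\<^sup>*"
  using assms
proof (induction p rule: induct_list012)
  case (3 x y zs)
  then have "(x, y) \<in> adj_rel \<Gamma>" by (simp add: adj_rel_def)
  moreover have "(y, last (y # zs)) \<in> (adj_rel \<Gamma>)\<^sup>*" using 3 by simp
  ultimately show ?case by (simp add: converse_rtrancl_into_rtrancl)
qed auto

text \<open>A path is in particular a walk, and a walk can be shortened to a path, so both relations
  reach the same vertices.\<close>

lemma path_rel_Image:
  assumes "u \<in> uverts \<Gamma>"
  shows "path_rel \<Gamma> `` {u} = (adj_rel \<Gamma>)\<^sup>* `` {u}"
proof (intro equalityI subsetI)
  fix v assume "v \<in> path_rel \<Gamma> `` {u}"
  then consider "u = v" | p where "ugraph_path \<Gamma> u p v"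
    by (auto simp: path_rel_def)
  then have "(u, v) \<in> (adj_rel \<Gamma>)\<^sup>*"
    by cases (use successively_imp_rtrancl in \<open>auto simp: ugraph_path_def\<close>)
  then show "v \<in> (adj_rel \<Gamma>)\<^sup>* `` {u}" by simp
next
  fix v assume "v \<in> (adj_rel \<Gamma>)\<^sup>* `` {u}"
  then have "(u, v) \<in> (adj_rel \<Gamma>)\<^sup>*" by simp
  then obtain p where p: "ugraph_path \<Gamma> u p v"
    using rtrancl_imp_ugraph_path[OF _ assms] by metis
  then have "v \<in> uverts \<Gamma>" by (auto simp: ugraph_path_def)
  then show "v \<in> path_rel \<Gamma> `` {u}"
    using assms p by (auto simp: path_rel_def)
qed

context group
begin

lemma adj_rel_cayley_graph_iff:
  "(u, v) \<in> adj_rel (cayley_graph G A) \<longleftrightarrow>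
     u \<in> carrier G \<and> v \<in> carrier G \<and> (\<exists>a \<in> A - {\<one>}. u = v \<otimes> a \<or> v = u \<otimes> a)"
  by (auto simp: adj_rel_def cayley_graph_def doubleton_eq_iff)

text \<open>The coset contains \<open>u\<close> and is closed under right multiplication by elements
  of \<open>A\<close> and their inverses, so no walk leaves it.\<close>

lemma rtrancl_adj_rel_cayley_graph_imp_l_coset:
  assumes "A \<subseteq> carrier G" "u \<in> carrier G" "(u, v) \<in> (adj_rel (cayley_graph G A))\<^sup>*"
  shows "v \<in> u <# generate G A"
  using assms(3)
proof induction
  case base
  show ?case using assms(2) generate.one[of G A] by (force simp: l_coset_def)
next
  case (step v w)
  then obtain h where h: "h \<in> generate G A" "v = u \<otimes> h" by (auto simp: l_coset_def)
  from step(2) obtain a where v: "v \<in> carrier G" and w: "w \<in> carrier G" and a: "a \<in> A"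
    and "v = w \<otimes> a \<or> w = v \<otimes> a"
    by (auto simp: adj_rel_cayley_graph_iff)
  moreover have "a \<in> carrier G" using a assms(1) by blast
  \<comment> \<open>The inverse arises when the edge is traversed from \<open>w \<otimes> a\<close>
    back to \<open>w\<close>.\<close>
  ultimately have "w = v \<otimes> inv a \<or> w = v \<otimes> a" by (auto simp: m_assoc)
  then obtain b where b: "b \<in> generate G A" "w = v \<otimes> b"
    using a generate.incl generate.inv by metis
  have "w = u \<otimes> (h \<otimes> b)"
    using b h assms(2) generate_in_carrier[OF assms(1)] by (simp add: m_assoc)
  then show ?case using generate.eng[OF h(1) b(1)] by (auto simp: l_coset_def)
qed

text \<open>The start \<open>u\<close> varies in the induction because a product
  \<open>h1 \<otimes> h2\<close> is walked as \<open>h1\<close> from \<open>u\<close>, then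
  \<open>h2\<close> from \<open>u \<otimes> h1\<close>.\<close>

lemma generate_imp_rtrancl_adj_rel_cayley_graph:
  assumes "A \<subseteq> carrier G" "h \<in> generate G A" "u \<in> carrier G"
  shows "(u, u \<otimes> h) \<in> (adj_rel (cayley_graph G A))\<^sup>*"
  using assms(2,3)
proof (induction arbitrary: u)
  case one
  then show ?case by simp
next
  case (incl a)
  \<comment> \<open>The identity gives no edge, but then the empty walk suffices.\<close>
  then have "a = \<one> \<or> (u, u \<otimes> a) \<in> adj_rel (cayley_graph G A)"
    using assms(1) by (auto simp: adj_rel_cayley_graph_iff)
  then show ?case using incl by auto
next
  case (inv a)
  then have a: "a \<in> carrier G" using assms(1) by auto
  then have "u = (u \<otimes> inv a) \<otimes> a" using inv by (simp add: m_assoc)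
  then have "a = \<one> \<or> (u, u \<otimes> inv a) \<in> adj_rel (cayley_graph G A)"
    using inv a by (auto simp: adj_rel_cayley_graph_iff)
  then show ?case using inv by auto
next
  case (eng h1 h2)
  then have "h1 \<in> carrier G" "h2 \<in> carrier G" using generate_in_carrier[OF assms(1)] by auto
  then show ?case using eng.IH(1)[of u] eng.IH(2)[of "u \<otimes> h1"] eng.prems
    by (simp add: m_assoc)
qed

lemma quotient_path_rel_cayley_graph:
  assumes "A \<subseteq> carrier G"
  shows "carrier G // path_rel (cayley_graph G A) = lcosets (generate G A)"
proof -
  have "path_rel (cayley_graph G A) `` {u} = u <# generate G A" if u: "u \<in> carrier G" for u
  proof -
    have "path_rel (cayley_graph G A) `` {u} = (adj_rel (cayley_graph G A))\<^sup>* `` {u}"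
      using u by (intro path_rel_Image) (simp add: cayley_graph_def)
    also have "\<dots> = u <# generate G A"
      using rtrancl_adj_rel_cayley_graph_imp_l_coset[OF assms u]
        generate_imp_rtrancl_adj_rel_cayley_graph[OF assms _ u]
      by (auto simp: l_coset_def)
    finally show ?thesis .
  qed
  then show ?thesis by (auto simp: quotient_def LCOSETS_def)
qed

end

theorem corollary2p6:
  fixes G :: "('a, 'm) monoid_scheme"
    and A :: "'a set"
    and C :: "'a ugraph"
    and D :: "('a, 'a \<times> 'a) pre_digraph"
  assumes "group G"
    and "A \<subseteq> carrier G"
  shows "(ugraph_component (cayley_graph G A) C \<longleftrightarrow>
            (\<exists>!X. X \<in> lcosets\<^bsub>G\<^esub> (generate G A) \<and> C = induce_ugraph (cayley_graph G A) X)) \<and>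
         (weak_component (cayley_digraph G A) D \<longleftrightarrow>
            (\<exists>!X. X \<in> lcosets\<^bsub>G\<^esub> (generate G A) \<and> D = induce_subgraph (cayley_digraph G A) X))"
proof -
  have verts: "uverts (cayley_graph G A) = carrier G" "verts (cayley_digraph G A) = carrier G"
    by (simp_all add: cayley_graph_def cayley_digraph_def)
  have inj: "X = Y" if "induce_ugraph (cayley_graph G A) X = induce_ugraph (cayley_graph G A) Y"
    for X Y using that by (simp add: induce_ugraph_def)
  have dinj: "X = Y"
    if "induce_subgraph (cayley_digraph G A) X = induce_subgraph (cayley_digraph G A) Y"
    for X Y using arg_cong[OF that, of verts] by simp
  show ?thesis
    \<comment> \<open>Both kinds of component now range over the same set of cosets; injectivity of
      inducing upgrades existence to unique existence.\<close>
    unfolding ugraph_component_def weak_component_def underlying_cayley_digraph[OF assms] verts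
      group.quotient_path_rel_cayley_graph[OF assms]
    using inj dinj by blast
qed

end
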